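(* Let $x^*$ be an optimal solution of $\min_{x\in\mathbb{R}^n}F(x)$, and let $0<\mu\le 1/\max_{1\le i\le K}L(f_i)$. Then the sequence $\{x_{(k)}^i,w_{(k)}^i,\hat w_{(k)}^i\}_{i=1}^K$ generated by Algorithm FaMSA (with starting point $x_0\in\mathbb{R}^n$, parameter $\mu$, and any doubly stochastic matrices $D^{(k)}$) satisfies, for all $k\ge 1$, $$\min_{i=1,\ldots,K}F(x_{(k)}^i)-F(x^* )\le\frac{2(K-1)\|x_0-x^*\|^2}{\mu(k+1)^2}.$$ Thus the sequence $\{\min_{i=1,\ldots,K}F(x_{(k)}^i)\}_k$ converges to $F(x^* )$. Moreover, if $\mu\ge\beta/\max_i\{L(f_i)\}$ where $0<\beta\le 1$, then for every $\epsilon>0$ the number of iterations needed to obtain an $\epsilon$-optimal solution (i.e. the smallest $k\ge 0$ with $\min_{i=1,\ldots,K}F(x_{(k)}^i)-F(x^* )\le\epsilon$) is at most $\lfloor\sqrt{C/\epsilon}\rfloor$, where $$C=\frac{2(K-1)\max_i\{L(f_i)\}\,\|x_0-x^*\|^2}{\beta}.$$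
   Context: Setting: $K\ge 2$ and $n\geq 1$ are integers, $\|\cdot\|$ is the Euclidean norm on $\mathbb{R}^n$. For $i=1,\ldots,K$, $f_i:\mathbb{R}^n\to\mathbb{R}$ is convex and continuously differentiable with Lipschitz continuous gradient: $\|\nabla f_i(x)-\nabla f_i(y)\|\le L(f_i)\|x-y\|$ for all $x,y\in\mathbb{R}^n$, where $L(f_i)$ is the Lipschitz constant ($\max_i L(f_i)>0$, so that $1/\max_i L(f_i)$ is defined). Put $F(x)=\sum_{i=1}^K f_i(x)$; it is assumed that $F$ attains its minimum on $\mathbb{R}^n$. A point $x$ is an $\epsilon$-optimal solution if $F(x)-F(x^* )\le\epsilon$, where $x^*$ is a minimizer of $F$. Notation: for $\mu>0$ let $\tilde f_j(u,v):=f_j(v)+\langle\nabla f_j(v),u-v\rangle+\frac{1}{2\mu}\|u-v\|^2$, and $$Q_i(v^1,\ldots,v^{i-1},u,v^{i+1},\ldots,v^K):=f_i(u)+\sum_{j=1,j\ne i}^K\tilde f_j(u,v^j),$$ $$p_i(v^1,\ldots,v^{i-1},v^{i+1},\ldots,v^K):=\arg\min_{u\in\mathbb{R}^n}Q_i(v^1,\ldots,v^{i-1},u,v^{i+1},\ldots,v^K).$$ In $p_i(w,\ldots,w)$ all $K-1$ arguments equal $w$. A real $K\times K$ matrix $D$ is doubly stochastic if its entries are nonnegative and all its row sums and column sums equal $1$. Algorithm FaMSA: let $D^{(1)},D^{(2)},\ldots$ be doubly stochastic $K\times K$ matrices. Set $x_0=x_{(0)}^i=\hat w_{(0)}^i=w_{(1)}^i$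 for $i=1,\ldots,K$, and $t_1=1$. For $k=1,2,\ldots$: (1) for $i=1,\ldots,K$ compute $x_{(k)}^i=p_i(w_{(k)}^i,\ldots,w_{(k)}^i)$; (2) compute $(\hat w_{(k)}^1,\ldots,\hat w_{(k)}^K):=(x_{(k)}^1,\ldots,x_{(k)}^K)D^{(k)}$, i.e. $\hat w_{(k)}^i=\sum_{j=1}^K D^{(k)}_{ji}x_{(k)}^j$; (3) compute $t_{k+1}=(1+\sqrt{1+4t_k^2})/2$; (4) for $i=1,\ldots,K$ compute $w_{(k+1)}^i:=\hat w_{(k)}^i+\frac{1}{t_{k+1}}\left(t_k(x_{(k)}^i-\hat w_{(k-1)}^i)-(\hat w_{(k)}^i-\hat w_{(k-1)}^i)\right)$. *)

theory Defs imports "HOL-Analysis.Analysis" begin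

definition grad :: "(real^'n \<Rightarrow> real) \<Rightarrow> real^'n \<Rightarrow> real^'n" where
  "grad f x = (THE D. GDERIV f x :> D)"

definition ftilde :: "real \<Rightarrow> (real^'n \<Rightarrow> real) \<Rightarrow> real^'n \<Rightarrow> real^'n \<Rightarrow> real" where
  "ftilde \<mu> f u v = f v + grad f v \<bullet> (u - v) + 1 / (2 * \<mu>) * (norm (u - v))\<^sup>2"

(* The indices 1, ..., K are the elements of a finite type 'k, so K = CARD('k).
   The tuple v carries the free argument u in its i-th slot. *)
definition Qfun ::
  "real \<Rightarrow> ('k::finite \<Rightarrow> real^'n \<Rightarrow> real) \<Rightarrow> 'k \<Rightarrow> ('k \<Rightarrow> real^'n) \<Rightarrow> real" where
  "Qfun \<mu> f i v = f i (v i) + (\<Sum>j\<in>UNIV - {i}. ftilde \<mu> (f j) (v i) (v j))"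

(* The i-th entry of v is overwritten and hence irrelevant. *)
definition pfun ::
  "real \<Rightarrow> ('k::finite \<Rightarrow> real^'n \<Rightarrow> real) \<Rightarrow> 'k \<Rightarrow> ('k \<Rightarrow> real^'n) \<Rightarrow> real^'n" where
  "pfun \<mu> f i v = arg_min (\<lambda>u. Qfun \<mu> f i (v(i := u))) (\<lambda>_. True)"

definition doubly_stochastic :: "real^'k^'k \<Rightarrow> bool" where
  "doubly_stochastic D \<longleftrightarrow>
     (\<forall>i j. 0 \<le> D $ i $ j) \<and>
     (\<forall>i. (\<Sum>j\<in>UNIV. D $ i $ j) = 1) \<and>
     (\<forall>j. (\<Sum>i\<in>UNIV. D $ i $ j) = 1)"

(* The sequences x, w, wh, t are generated by FaMSA from x0 (wh is the sequence w-hat).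
   The values w 0, t 0 and D 0 play no role. *)
definition FaMSA ::
  "('k::finite \<Rightarrow> real^'n \<Rightarrow> real) \<Rightarrow> real \<Rightarrow> (nat \<Rightarrow> real^'k^'k) \<Rightarrow> real^'n \<Rightarrow>
   (nat \<Rightarrow> 'k \<Rightarrow> real^'n) \<Rightarrow> (nat \<Rightarrow> 'k \<Rightarrow> real^'n) \<Rightarrow> (nat \<Rightarrow> 'k \<Rightarrow> real^'n) \<Rightarrow>
   (nat \<Rightarrow> real) \<Rightarrow> bool" where
  "FaMSA f \<mu> D x0 x w wh t \<longleftrightarrow>
     (\<forall>i. x 0 i = x0 \<and> wh 0 i = x0 \<and> w 1 i = x0) \<and> t 1 = 1 \<and>
     (\<forall>k\<ge>1.
        (\<forall>i. x k i = pfun \<mu> f i (\<lambda>_. w k i)) \<and>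
        (\<forall>i. wh k i = (\<Sum>j\<in>UNIV. (D k $ j $ i) *\<^sub>R x k j)) \<and>
        t (k + 1) = (1 + sqrt (1 + 4 * (t k)\<^sup>2)) / 2 \<and>
        (\<forall>i. w (k + 1) i = wh k i + (1 / t (k + 1)) *\<^sub>R
           (t k *\<^sub>R (x k i - wh (k - 1) i) - (wh k i - wh (k - 1) i))))"

end

theory Submission imports Defs begin

text \<open>
  Each \<^term>\<open>x k i\<close> minimizes a convex function plus \<open>c * norm (u - w k i)^2\<close>, where
  \<open>c = (K - 1) / (2 * \<mu>)\<close>. As \<open>1 / \<mu>\<close> bounds all Lipschitz constants, this function majorizes
  \<open>F\<close>, and strong convexity gives \<open>F (x k i) + c * norm (u - x k i)^2 \<le> F u + c * norm (u - w k i)^2\<close>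
  for all \<open>u\<close>. The choice \<open>u = (1 - 1 / t k) *\<^sub>R wh (k - 1) i + (1 / t k) *\<^sub>R xstar\<close> turns
  this, after multiplication by \<open>(t k)^2\<close>, into a telescoping inequality as for FISTA. Passing from
  \<open>x k\<close> to \<open>wh k\<close> does not increase the sum of \<open>F\<close> over all \<open>i\<close>, because \<open>F\<close> is convex and
  \<open>D k\<close> is doubly stochastic.
\<close>

section \<open>Gradients, tangent bounds and the descent lemma\<close>

lemma GDERIV_exists:
  fixes f :: "'a::euclidean_space \<Rightarrow> real"
  assumes "f differentiable (at x)"
  shows "\<exists>D. GDERIV f x :> D"
proof -
  obtain f' where f': "(f has_derivative f') (at x)"
    using assms by (auto simp: differentiable_def)
  then have "linear f'" by (rule has_derivative_linear)
  \<comment> \<open>The adjoint applied to 1 is the Riesz representative of the linear functional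
    \<open>f'\<close>.\<close>
  then have "f' = (\<lambda>h. h \<bullet> adjoint f' 1)"
    using adjoint_works[of f' _ 1] by (simp add: fun_eq_iff)
  with f' show ?thesis unfolding gderiv_def by metis
qed

lemma GDERIV_unique:
  assumes "GDERIV f x :> D" "GDERIV f x :> E"
  shows "D = E"
proof -
  have "(\<lambda>h. h \<bullet> D) = (\<lambda>h. h \<bullet> E)"
    using assms unfolding gderiv_def by (rule has_derivative_unique)
  then have "\<And>h. h \<bullet> D = h \<bullet> E" by meson
  then show ?thesis by (metis inner_commute vector_eq_rdot)
qed

text \<open>\<open>grad\<close> is a definite description, so it denotes the gradient only once
  existence and uniqueness are both known.\<close>

lemma GDERIV_grad:
  assumes "f differentiable (at x)"
  shows "GDERIV f x :> grad f x"
  unfolding grad_def using GDERIV_exists[OF assms] GDERIV_unique by (metis theI)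

lemma GDERIV_line:
  assumes "GDERIV f (v + s *\<^sub>R d) :> D"
  shows "((\<lambda>s. f (v + s *\<^sub>R d)) has_real_derivative D \<bullet> d) (at s)"
proof -
  have "((\<lambda>s. v + s *\<^sub>R d) has_derivative (\<lambda>h. h *\<^sub>R d)) (at s)"
    by (auto intro!: derivative_eq_intros)
  from diff_chain_at[OF this assms[unfolded gderiv_def]]
  show ?thesis
    by (simp add: o_def has_field_derivative_def inner_commute mult_commute_abs)
qed

text \<open>Restriction to the line through \<open>v\<close> and \<open>u\<close> reduces the claim
  to the tangent inequality for convex functions of one real variable.\<close>

lemma convex_above_tangent:
  assumes "convex_on UNIV f" "f differentiable (at v)"
  shows "f v + grad f v \<bullet> (u - v) \<le> f u"
proof -
  define g where "g s = f (v + s *\<^sub>R (u - v))" for s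
  have "convex_on UNIV g"
  proof (rule convex_onI)
    fix r a b :: real assume r: "0 < r" "r < 1"
    have "v + ((1 - r) *\<^sub>R a + r *\<^sub>R b) *\<^sub>R (u - v)
        = (1 - r) *\<^sub>R (v + a *\<^sub>R (u - v)) + r *\<^sub>R (v + b *\<^sub>R (u - v))"
      by (simp add: algebra_simps)
    then show "g ((1 - r) *\<^sub>R a + r *\<^sub>R b) \<le> (1 - r) * g a + r * g b"
      unfolding g_def using convex_onD[OF assms(1), of r] r by simp
  qed simp
  moreover have "(g has_real_derivative grad f v \<bullet> (u - v)) (at 0)"
    unfolding g_def using GDERIV_line[of f v 0 "u - v"] GDERIV_grad[OF assms(2)] by simp
  ultimately have "g 1 - g 0 \<ge> grad f v \<bullet> (u - v) * (1 - 0)"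
    by (intro convex_on_imp_above_tangent[where A = UNIV]) auto
  then show ?thesis by (simp add: g_def)
qed

lemma lipschitz_grad_upper_bound:
  assumes diff: "\<And>y. f differentiable (at y)" and lip: "L-lipschitz_on UNIV (grad f)"
  shows "f u \<le> f v + grad f v \<bullet> (u - v) + L / 2 * (norm (u - v))\<^sup>2"
proof -
  define d where "d = u - v"
  define g where "g s = f (v + s *\<^sub>R d) - s * (grad f v \<bullet> d) - L / 2 * s\<^sup>2 * (norm d)\<^sup>2" for s
  have "g 1 \<le> g 0"
  proof (rule DERIV_nonpos_imp_nonincreasing[of 0 1 g])
    fix s :: real assume s: "0 \<le> s" "s \<le> 1"
    define y where "y = v + s *\<^sub>R d"
    have "((\<lambda>s. f (v + s *\<^sub>R d)) has_real_derivative grad f y \<bullet> d) (at s)"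
      using GDERIV_line[of f v s d] GDERIV_grad[OF diff] by (simp add: y_def)
    then have "(g has_real_derivative (grad f y - grad f v) \<bullet> d - L * s * (norm d)\<^sup>2) (at s)"
      unfolding g_def by (auto intro!: derivative_eq_intros simp: inner_diff_left)
    moreover have "(grad f y - grad f v) \<bullet> d \<le> L * s * (norm d)\<^sup>2"
    proof -
      have "(grad f y - grad f v) \<bullet> d \<le> norm (grad f y - grad f v) * norm d"
        by (rule norm_cauchy_schwarz)
      also have "\<dots> \<le> (L * norm (y - v)) * norm d"
        using lipschitz_onD[OF lip, of y v] by (intro mult_right_mono) (auto simp: dist_norm)
      also have "\<dots> = L * s * (norm d)\<^sup>2"
        using s by (simp add: y_def power2_eq_square)
      finally show ?thesis .
    qed
    ultimately show "\<exists>z. (g has_real_derivative z) (at s) \<and> z \<le> 0"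
      by (intro exI conjI) auto
  qed simp
  then show ?thesis by (simp add: g_def d_def)
qed

section \<open>Strong convexity and proximal minimizers\<close>

lemma convex_combination_norm_sq:
  fixes a b :: "'a::real_inner"
  shows "(norm ((1 - s) *\<^sub>R a + s *\<^sub>R b))\<^sup>2
    = (1 - s) * (norm a)\<^sup>2 + s * (norm b)\<^sup>2 - s * (1 - s) * (norm (a - b))\<^sup>2"
  unfolding power2_norm_eq_inner
  by (simp add: inner_add_left inner_add_right inner_diff_left inner_diff_right
      inner_commute algebra_simps)

text \<open>The gain \<open>c * (norm (u - p))\<^sup>2\<close> comes from comparing \<open>p\<close>
  with nearby points of the segment towards \<open>u\<close>, where the squared norm is convex with
  an explicit defect.\<close>

lemma prox_minimizer_bound:
  fixes h :: "'a::real_inner \<Rightarrow> real"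
  assumes conv: "convex_on UNIV h"
    and min: "\<And>u. h p + c * (norm (p - w))\<^sup>2 \<le> h u + c * (norm (u - w))\<^sup>2"
  shows "h p + c * (norm (p - w))\<^sup>2 + c * (norm (u - p))\<^sup>2 \<le> h u + c * (norm (u - w))\<^sup>2"
proof -
  define \<phi> where "\<phi> u = h u + c * (norm (u - w))\<^sup>2" for u
  have ineq: "\<phi> p + (1 - s) * (c * (norm (u - p))\<^sup>2) \<le> \<phi> u" if s: "0 < s" "s < 1" for s :: real
  proof -
    define z where "z = (1 - s) *\<^sub>R p + s *\<^sub>R u"
    have zw: "z - w = (1 - s) *\<^sub>R (p - w) + s *\<^sub>R (u - w)"
      by (simp add: z_def algebra_simps)
    have "h z \<le> (1 - s) * h p + s * h u"
      unfolding z_def using convex_onD[OF conv, of s] s by simp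
    moreover have "\<phi> p \<le> \<phi> z" unfolding \<phi>_def by (rule min)
    \<comment> \<open>The defect carries the factor \<open>s\<close>; dividing the whole inequality
      by \<open>s\<close> leaves it with weight \<open>1 - s\<close>.\<close>
    moreover have "(norm (z - w))\<^sup>2 = (1 - s) * (norm (p - w))\<^sup>2 + s * (norm (u - w))\<^sup>2
        - s * (1 - s) * (norm (u - p))\<^sup>2"
      unfolding zw convex_combination_norm_sq by (simp add: norm_minus_commute)
    ultimately have "\<phi> p \<le> (1 - s) * \<phi> p + s * \<phi> u - s * ((1 - s) * (c * (norm (u - p))\<^sup>2))"
      by (simp add: \<phi>_def algebra_simps)
    then have "s * (\<phi> p + (1 - s) * (c * (norm (u - p))\<^sup>2)) \<le> s * \<phi> u"
      by (simp add: algebra_simps)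
    with s show ?thesis by simp
  qed
  \<comment> \<open>Letting \<open>s\<close> tend to 0 recovers the full coefficient
    \<open>c\<close>.\<close>
  have "((\<lambda>s. \<phi> p + (1 - s) * (c * (norm (u - p))\<^sup>2))
      \<longlongrightarrow> \<phi> p + (1 - 0) * (c * (norm (u - p))\<^sup>2)) (at_right 0)"
    by (intro tendsto_intros)
  moreover have "eventually (\<lambda>s. \<phi> p + (1 - s) * (c * (norm (u - p))\<^sup>2) \<le> \<phi> u) (at_right (0::real))"
    using ineq by (auto simp: eventually_at_right_field intro!: exI[of _ 1])
  ultimately have "\<phi> p + (1 - 0) * (c * (norm (u - p))\<^sup>2) \<le> \<phi> u"
    by (intro tendsto_upperbound) auto
  then show ?thesis by (simp add: \<phi>_def)
qed

text \<open>Beyond the radius \<open>norm g / c\<close> the quadratic term outweighs the linear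
  lower bound, so values there are at least the value at the centre \<open>w\<close>. A minimizer
  over the compact ball is therefore global.\<close>

lemma prox_minimizer_exists:
  fixes h :: "'a::euclidean_space \<Rightarrow> real"
  assumes cont: "continuous_on UNIV h" and c: "c > 0"
    and tangent: "\<And>u. h w + g \<bullet> (u - w) \<le> h u"
  shows "\<exists>p. \<forall>u. h p + c * (norm (p - w))\<^sup>2 \<le> h u + c * (norm (u - w))\<^sup>2"
proof -
  define \<phi> where "\<phi> u = h u + c * (norm (u - w))\<^sup>2" for u
  define r where "r = norm g / c"
  have "r \<ge> 0" using c by (simp add: r_def)
  have "continuous_on (cball w r) \<phi>"
    unfolding \<phi>_def by (intro continuous_intros continuous_on_subset[OF cont]) auto
  then obtain p where p: "\<And>u. u \<in> cball w r \<Longrightarrow> \<phi> p \<le> \<phi> u"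
    using continuous_attains_inf[of "cball w r" \<phi>] \<open>r \<ge> 0\<close> by (metis cball_eq_empty compact_cball not_less)
  have "\<phi> p \<le> \<phi> u" for u
  proof (cases "u \<in> cball w r")
    case False
    then have "norm g \<le> c * norm (u - w)"
      using c by (simp add: r_def dist_norm norm_minus_commute field_simps)
    then have "norm g * norm (u - w) \<le> c * norm (u - w) * norm (u - w)"
      by (rule mult_right_mono) simp
    moreover have "- (g \<bullet> (u - w)) \<le> norm g * norm (u - w)"
      using Cauchy_Schwarz_ineq2[of g "u - w"] by linarith
    ultimately have "\<phi> w \<le> \<phi> u"
      using tangent[of u] by (simp add: \<phi>_def power2_eq_square mult.assoc)
    moreover have "\<phi> p \<le> \<phi> w" using p \<open>r \<ge> 0\<close> by simp
    ultimately show ?thesis by linarith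
  qed (rule p)
  then show ?thesis unfolding \<phi>_def by blast
qed

section \<open>Estimates for a single iteration\<close>

lemma arg_min_le:
  fixes g :: "'a \<Rightarrow> 'b::linorder"
  assumes "\<exists>p. \<forall>u. g p \<le> g u"
  shows "g (arg_min g (\<lambda>_. True)) \<le> g u"
proof -
  have "is_arg_min g (\<lambda>_. True) (arg_min g (\<lambda>_. True))"
    unfolding arg_min_def using assms by (metis is_arg_min_linorder someI_ex)
  then show ?thesis by (simp add: is_arg_min_linorder)
qed

text \<open>\<open>F\<close> is compared with the model on both sides: at \<open>p\<close> the upper
  models \<open>ftilde\<close> lie above the components, while at \<open>u\<close> the tangents
  collected in \<open>h\<close> lie below them. The proximal inequality for \<open>h\<close> links
  the two points.\<close>

lemma pfun_step_bound:
  fixes f :: "'k::finite \<Rightarrow> real^'n \<Rightarrow> real" and \<mu> :: real and i :: 'k and w :: "real^'n"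
  defines "c \<equiv> (real CARD('k) - 1) / (2 * \<mu>)"
    and "p \<equiv> pfun \<mu> f i (\<lambda>_. w)"
  assumes K: "CARD('k) \<ge> 2"
    and convex: "\<And>i. convex_on UNIV (f i)"
    and diff: "\<And>i y. f i differentiable (at y)"
    and upper: "\<And>j u v. f j u \<le> ftilde \<mu> (f j) u v"
    and mu: "0 < \<mu>"
  shows "(\<Sum>j\<in>UNIV. f j p) + c * (norm (u - p))\<^sup>2 \<le> (\<Sum>j\<in>UNIV. f j u) + c * (norm (u - w))\<^sup>2"
proof -
  define h where "h u = f i u + (\<Sum>j\<in>UNIV - {i}. f j w + grad (f j) w \<bullet> (u - w))" for u
  have split: "sum g UNIV = g i + sum g (UNIV - {i})" for g :: "'k \<Rightarrow> real"
    by (simp add: sum.remove)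
  \<comment> \<open>All arguments equal \<open>w\<close>, so the \<open>K - 1\<close> quadratic
    terms share one centre and add up to the weight \<open>c\<close>.\<close>
  have Q: "Qfun \<mu> f i ((\<lambda>_. w)(i := u)) = h u + c * (norm (u - w))\<^sup>2" for u
    using K
    by (simp add: Qfun_def h_def c_def ftilde_def sum.distrib of_nat_diff diff_divide_distrib
        left_diff_distrib)
  have c: "c > 0" using K mu by (simp add: c_def)
  have "continuous_on UNIV (f i)"
    by (rule differentiable_imp_continuous_on) (simp add: differentiable_on_def diff)
  then have cont: "continuous_on UNIV h"
    unfolding h_def by (intro continuous_intros)
  have conv: "convex_on UNIV h"
  proof (rule convex_onI)
    fix s :: real and a b :: "real^'n" assume s: "0 < s" "s < 1"
    have "(\<Sum>j\<in>UNIV - {i}. f j w + grad (f j) w \<bullet> ((1 - s) *\<^sub>R a + s *\<^sub>R b - w))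
      = (1 - s) * (\<Sum>j\<in>UNIV - {i}. f j w + grad (f j) w \<bullet> (a - w))
        + s * (\<Sum>j\<in>UNIV - {i}. f j w + grad (f j) w \<bullet> (b - w))"
      unfolding sum_distrib_left sum.distrib[symmetric]
      by (intro sum.cong) (auto simp: inner_diff_right inner_add_right algebra_simps)
    then show "h ((1 - s) *\<^sub>R a + s *\<^sub>R b) \<le> (1 - s) * h a + s * h b"
      using convex_onD[OF convex[of i], of s a b] s by (simp add: h_def algebra_simps)
  qed simp
  \<comment> \<open>The terms with \<open>j\<close> other than \<open>i\<close> are already affine;
    only \<open>f i\<close> needs convexity.\<close>
  have "h w + (\<Sum>j\<in>UNIV. grad (f j) w) \<bullet> (u - w) \<le> h u" for u
    using convex_above_tangent[OF convex diff, of i w u]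
    by (simp add: h_def split inner_add_left inner_sum_left sum.distrib)
  note ex = prox_minimizer_exists[OF cont c this]
  \<comment> \<open>\<open>arg_min\<close> is a choice operator; the attainment fact
    \<open>ex\<close> makes \<open>p\<close> a genuine minimizer.\<close>
  have "h p + c * (norm (p - w))\<^sup>2 \<le> h u + c * (norm (u - w))\<^sup>2" for u
    unfolding p_def pfun_def Q by (rule arg_min_le[OF ex])
  note bound = prox_minimizer_bound[OF conv this]
  have "(\<Sum>j\<in>UNIV. f j p) \<le> Qfun \<mu> f i ((\<lambda>_. w)(i := p))"
    unfolding Qfun_def split using upper by (auto intro!: sum_mono)
  moreover have "h u \<le> (\<Sum>j\<in>UNIV. f j u)"
    unfolding h_def split using convex_above_tangent[OF convex diff]
    by (auto intro!: sum_mono)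
  ultimately show ?thesis using bound[of u] Q by simp
qed

text \<open>Here \<open>v\<close> plays the role of \<open>wh (k - 1) i\<close>.\<close>

lemma accelerated_step:
  fixes F :: "'a::real_inner \<Rightarrow> real"
  assumes conv: "convex_on UNIV F" and \<tau>: "\<tau> \<ge> 1"
    and step: "\<And>u. F p + c * (norm (u - p))\<^sup>2 \<le> F u + c * (norm (u - w))\<^sup>2"
  shows "\<tau>\<^sup>2 * (F p - F z) + c * (norm (\<tau> *\<^sub>R p - (\<tau> - 1) *\<^sub>R v - z))\<^sup>2
    \<le> (\<tau>\<^sup>2 - \<tau>) * (F v - F z) + c * (norm (\<tau> *\<^sub>R w - (\<tau> - 1) *\<^sub>R v - z))\<^sup>2"
proof -
  define u where "u = (1 - 1 / \<tau>) *\<^sub>R v + (1 / \<tau>) *\<^sub>R z"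
  have \<tau>u: "\<tau> *\<^sub>R u = (\<tau> - 1) *\<^sub>R v + z"
    using \<tau> by (simp add: u_def algebra_simps)
  have norm: "(norm (\<tau> *\<^sub>R y - (\<tau> - 1) *\<^sub>R v - z))\<^sup>2 = \<tau>\<^sup>2 * (norm (u - y))\<^sup>2" for y
  proof -
    have "\<tau> *\<^sub>R y - (\<tau> - 1) *\<^sub>R v - z = \<tau> *\<^sub>R (y - u)"
      unfolding scaleR_diff_right \<tau>u by simp
    then show ?thesis by (simp add: norm_minus_commute power_mult_distrib)
  qed
  \<comment> \<open>As \<open>\<tau> \<ge> 1\<close>, the point \<open>u\<close> is a convex
    combination of \<open>v\<close> and \<open>z\<close>. Scaling by \<open>\<tau>\<^sup>2\<close>
    then creates the coefficient \<open>\<tau>\<^sup>2 - \<tau>\<close>, which the recursion for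
    \<open>t\<close> matches with the square of the previous parameter.\<close>
  have "F u \<le> (1 - 1 / \<tau>) * F v + 1 / \<tau> * F z"
    unfolding u_def using convex_onD[OF conv, of "1 / \<tau>"] \<tau> by simp
  then have "\<tau>\<^sup>2 * F u \<le> \<tau>\<^sup>2 * ((1 - 1 / \<tau>) * F v + 1 / \<tau> * F z)"
    by (rule mult_left_mono) simp
  also have "\<dots> = (\<tau>\<^sup>2 - \<tau>) * F v + \<tau> * F z"
    using \<tau> by (simp add: field_simps power2_eq_square)
  finally have "\<tau>\<^sup>2 * F u \<le> (\<tau>\<^sup>2 - \<tau>) * F v + \<tau> * F z" .
  moreover have "\<tau>\<^sup>2 * (F p + c * (norm (u - p))\<^sup>2) \<le> \<tau>\<^sup>2 * (F u + c * (norm (u - w))\<^sup>2)"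
    by (intro mult_left_mono step) simp
  ultimately show ?thesis unfolding norm by (simp add: algebra_simps)
qed

text \<open>Column sums equal to 1 allow Jensen's inequality for each \<open>i\<close>; after
  exchanging the sums, row sums equal to 1 give every \<open>F (y j)\<close> total weight 1.\<close>

lemma doubly_stochastic_convex_sum:
  fixes D :: "real^'k^'k" and F :: "'a::real_vector \<Rightarrow> real"
  assumes D: "doubly_stochastic D" and conv: "convex_on UNIV F"
  shows "(\<Sum>i\<in>UNIV. F (\<Sum>j\<in>UNIV. (D $ j $ i) *\<^sub>R y j)) \<le> (\<Sum>j\<in>UNIV. F (y j))"
proof -
  have "(\<Sum>i\<in>UNIV. F (\<Sum>j\<in>UNIV. (D $ j $ i) *\<^sub>R y j))
      \<le> (\<Sum>i\<in>UNIV. \<Sum>j\<in>UNIV. D $ j $ i * F (y j))"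
    using D by (intro sum_mono convex_on_sum[OF _ _ conv]) (auto simp: doubly_stochastic_def)
  also have "\<dots> = (\<Sum>j\<in>UNIV. (\<Sum>i\<in>UNIV. D $ j $ i) * F (y j))"
    unfolding sum_distrib_right by (rule sum.swap)
  also have "\<dots> = (\<Sum>j\<in>UNIV. F (y j))"
    using D by (simp add: doubly_stochastic_def)
  finally show ?thesis .
qed

section \<open>Step parameters and decay of the potential\<close>

lemma FISTA_parameters:
  fixes t :: "nat \<Rightarrow> real"
  assumes "t 1 = 1" and t: "\<And>k. k \<ge> 1 \<Longrightarrow> t (k + 1) = (1 + sqrt (1 + 4 * (t k)\<^sup>2)) / 2"
    and k: "k \<ge> 1"
  shows "t k \<ge> (real k + 1) / 2" and "(t (k + 1))\<^sup>2 - t (k + 1) = (t k)\<^sup>2"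
proof -
  show "t k \<ge> (real k + 1) / 2"
    using k
  proof (induction k rule: nat_induct_at_least)
    case base
    then show ?case using \<open>t 1 = 1\<close> by simp
  next
    case (Suc k)
    \<comment> \<open>Hence \<open>t\<close> grows by at least 1/2 in each step.\<close>
    have "2 * t k \<le> sqrt (1 + 4 * (t k)\<^sup>2)"
      by (rule real_le_rsqrt) (simp add: power_mult_distrib)
    then show ?case using Suc t[of k] by simp
  qed
  \<comment> \<open>The recursion is the quadratic formula for a root of
    \<open>y\<^sup>2 - y = (t k)\<^sup>2\<close>.\<close>
  have "(sqrt (1 + 4 * (t k)\<^sup>2))\<^sup>2 = 1 + 4 * (t k)\<^sup>2"
    by (simp add: add_nonneg_nonneg)
  then show "(t (k + 1))\<^sup>2 - t (k + 1) = (t k)\<^sup>2"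
    unfolding t[OF k] by (simp add: power2_eq_square field_simps)
qed

text \<open>The left-hand side is a Lyapunov function that does not increase with \<open>k\<close>.
  It is summed over \<open>i\<close> because the mixing by \<open>D k\<close> is controlled only in
  total, not index by index.\<close>

lemma FaMSA_potential_bound:
  fixes f :: "'k::finite \<Rightarrow> real^'n \<Rightarrow> real" and t :: "nat \<Rightarrow> real"
  assumes famsa: "FaMSA f \<mu> D x0 x w wh t"
    and D: "\<And>k. k \<ge> 1 \<Longrightarrow> doubly_stochastic (D k)"
    and conv: "convex_on UNIV F"
    and step: "\<And>i w u. F (pfun \<mu> f i (\<lambda>_. w)) + c * (norm (u - pfun \<mu> f i (\<lambda>_. w)))\<^sup>2
      \<le> F u + c * (norm (u - w))\<^sup>2"
    and k: "k \<ge> 1"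
  shows "(\<Sum>i\<in>UNIV. (t k)\<^sup>2 * (F (x k i) - F z)
      + c * (norm (t k *\<^sub>R x k i - (t k - 1) *\<^sub>R wh (k - 1) i - z))\<^sup>2)
    \<le> real CARD('k) * (c * (norm (x0 - z))\<^sup>2)"
proof -
  have init: "\<And>i. wh 0 i = x0" "\<And>i. w 1 i = x0" and t1: "t 1 = 1"
    and x: "\<And>k i. k \<ge> 1 \<Longrightarrow> x k i = pfun \<mu> f i (\<lambda>_. w k i)"
    and wh: "\<And>k i. k \<ge> 1 \<Longrightarrow> wh k i = (\<Sum>j\<in>UNIV. (D k $ j $ i) *\<^sub>R x k j)"
    and t: "\<And>k. k \<ge> 1 \<Longrightarrow> t (k + 1) = (1 + sqrt (1 + 4 * (t k)\<^sup>2)) / 2"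
    and w: "\<And>k i. k \<ge> 1 \<Longrightarrow> w (k + 1) i = wh k i + (1 / t (k + 1)) *\<^sub>R
           (t k *\<^sub>R (x k i - wh (k - 1) i) - (wh k i - wh (k - 1) i))"
    using famsa by (auto simp: FaMSA_def)
  have t_ge: "t k \<ge> (real k + 1) / 2" and t_sq: "(t (k + 1))\<^sup>2 - t (k + 1) = (t k)\<^sup>2"
    if "k \<ge> 1" for k
    by (rule FISTA_parameters[of t, OF t1 _ that], rule t, assumption)+
  have step_k: "(t k)\<^sup>2 * (F (x k i) - F z)
      + c * (norm (t k *\<^sub>R x k i - (t k - 1) *\<^sub>R wh (k - 1) i - z))\<^sup>2
    \<le> ((t k)\<^sup>2 - t k) * (F (wh (k - 1) i) - F z)
      + c * (norm (t k *\<^sub>R w k i - (t k - 1) *\<^sub>R wh (k - 1) i - z))\<^sup>2" if "k \<ge> 1" for k i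
    unfolding x[OF that] using t_ge[OF that] that
    by (intro accelerated_step conv step) simp
  show ?thesis
    using k
  proof (induction k rule: nat_induct_at_least)
    case base
    show ?case
    proof -
      \<comment> \<open>Since \<open>t 1 = 1\<close>, the coefficient
        \<open>(t 1)\<^sup>2 - t 1\<close> vanishes and only the distance from the common starting
        point remains.\<close>
      have "(\<Sum>i\<in>UNIV. (t 1)\<^sup>2 * (F (x 1 i) - F z)
          + c * (norm (t 1 *\<^sub>R x 1 i - (t 1 - 1) *\<^sub>R wh (1 - 1) i - z))\<^sup>2)
        \<le> (\<Sum>i\<in>(UNIV::'k set). c * (norm (x0 - z))\<^sup>2)"
        using step_k[of 1] by (intro sum_mono) (simp only: t1 init, simp)
      then show ?thesis by simp
    qed
  next
    case (Suc k)
    have "t (k + 1) > 0" using t_ge[of "k + 1"] by simp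
    \<comment> \<open>The extrapolation defining \<open>w (k + 1)\<close> is chosen so that the
      distance term on the right of step \<open>k + 1\<close> is the one on the left of step
      \<open>k\<close>; this makes the estimate telescope.\<close>
    then have shift: "t (k + 1) *\<^sub>R w (k + 1) i - (t (k + 1) - 1) *\<^sub>R wh k i
        = t k *\<^sub>R x k i - (t k - 1) *\<^sub>R wh (k - 1) i" for i
      unfolding w[OF Suc.hyps] by (simp add: scaleR_add_right) (simp add: algebra_simps)
    have "(\<Sum>i\<in>UNIV. (t (k + 1))\<^sup>2 * (F (x (k + 1) i) - F z)
        + c * (norm (t (k + 1) *\<^sub>R x (k + 1) i - (t (k + 1) - 1) *\<^sub>R wh k i - z))\<^sup>2)
      \<le> (\<Sum>i\<in>UNIV. (t k)\<^sup>2 * (F (wh k i) - F z)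
        + c * (norm (t k *\<^sub>R x k i - (t k - 1) *\<^sub>R wh (k - 1) i - z))\<^sup>2)"
      using step_k[of "k + 1"] unfolding t_sq[OF Suc.hyps]
      by (intro sum_mono) (simp add: shift[simplified])
    \<comment> \<open>Only the function values contain the mixed points \<open>wh k\<close>; the
      distance terms are carried over unchanged.\<close>
    also have "\<dots> \<le> (\<Sum>i\<in>UNIV. (t k)\<^sup>2 * (F (x k i) - F z)
        + c * (norm (t k *\<^sub>R x k i - (t k - 1) *\<^sub>R wh (k - 1) i - z))\<^sup>2)"
      using doubly_stochastic_convex_sum[OF D[OF Suc.hyps] conv, of "x k"]
      by (simp add: wh[OF Suc.hyps] sum.distrib sum_distrib_left[symmetric] sum_subtractf mult_left_mono)
    also have "\<dots> \<le> real CARD('k) * (c * (norm (x0 - z))\<^sup>2)"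
      by (rule Suc.IH)
    finally show ?case by simp
  qed
qed

section \<open>Convergence rate and iteration count\<close>

theorem theorem3p2:
  fixes f :: "'k::finite \<Rightarrow> real^'n \<Rightarrow> real"
    and F :: "real^'n \<Rightarrow> real"
    and L :: "'k \<Rightarrow> real"
    and \<mu> :: real
    and D :: "nat \<Rightarrow> real^'k^'k"
    and x0 xstar :: "real^'n"
    and x w wh :: "nat \<Rightarrow> 'k \<Rightarrow> real^'n"
    and t :: "nat \<Rightarrow> real"
    and best :: "nat \<Rightarrow> real"
  assumes K: "CARD('k) \<ge> 2"
    and convex: "\<And>i. convex_on UNIV (f i)"
    and differentiable: "\<And>i y. f i differentiable (at y)"
    and C1: "\<And>i. continuous_on UNIV (grad (f i))"
    and lipschitz: "\<And>i. (L i)-lipschitz_on UNIV (grad (f i))"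
    and Lpos: "Max (range L) > 0"
    and F: "F = (\<lambda>y. \<Sum>i\<in>UNIV. f i y)"
    and xstar: "is_arg_min F (\<lambda>_. True) xstar"
    and mu: "0 < \<mu>" "\<mu> \<le> 1 / Max (range L)"
    and D: "\<And>k. k \<ge> 1 \<Longrightarrow> doubly_stochastic (D k)"
    and famsa: "FaMSA f \<mu> D x0 x w wh t"
    and best: "best = (\<lambda>k. Min (range (\<lambda>i. F (x k i))))"
  shows "(\<forall>k\<ge>1. best k - F xstar
            \<le> 2 * (real CARD('k) - 1) * (norm (x0 - xstar))\<^sup>2 / (\<mu> * (real k + 1)\<^sup>2)) \<and>
         best \<longlonglongrightarrow> F xstar \<and>
         (\<forall>\<beta> C \<epsilon>. 0 < \<beta> \<longrightarrow> \<beta> \<le> 1 \<longrightarrow> \<mu> \<ge> \<beta> / Max (range L) \<longrightarrow>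
            C = 2 * (real CARD('k) - 1) * Max (range L) * (norm (x0 - xstar))\<^sup>2 / \<beta> \<longrightarrow>
            \<epsilon> > 0 \<longrightarrow>
            (\<exists>k. best k - F xstar \<le> \<epsilon>) \<and>
            int (LEAST k. best k - F xstar \<le> \<epsilon>) \<le> \<lfloor>sqrt (C / \<epsilon>)\<rfloor>)"
proof -
  define M where "M = Max (range L)"
  define c where "c = (real CARD('k) - 1) / (2 * \<mu>)"
  define R where "R = (norm (x0 - xstar))\<^sup>2"
  have M: "M > 0" and LM: "L i \<le> M" for i
    using Lpos by (auto simp: M_def)
  have mu_M: "M \<le> 1 / \<mu>" using mu M by (simp add: M_def field_simps)
  have K1: "real CARD('k) \<ge> 2" using K by linarith
  have R: "R \<ge> 0" and c: "c > 0" using K1 mu by (simp_all add: R_def c_def)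
  \<comment> \<open>The constant \<open>a\<close> stays free: it becomes \<open>1 / \<mu>\<close>
    for the majorization by \<open>ftilde\<close> and \<open>M\<close> for the estimate at the
    starting point.\<close>
  have descent: "f j u \<le> f j v + grad (f j) v \<bullet> (u - v) + a / 2 * (norm (u - v))\<^sup>2"
    if "L j \<le> a" for j u v a
  proof -
    have "L j / 2 * (norm (u - v))\<^sup>2 \<le> a / 2 * (norm (u - v))\<^sup>2"
      using that by (intro mult_right_mono) auto
    then show ?thesis
      using lipschitz_grad_upper_bound[OF differentiable lipschitz, of j u v] by linarith
  qed
  have upper: "f j u \<le> ftilde \<mu> (f j) u v" for j u v
    using descent[OF order.trans[OF LM mu_M], of j u v] by (simp add: ftilde_def)
  have conv: "convex_on UNIV F"
  proof (rule convex_onI)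
    fix s :: real and a b :: "real^'n" assume s: "0 < s" "s < 1"
    show "F ((1 - s) *\<^sub>R a + s *\<^sub>R b) \<le> (1 - s) * F a + s * F b"
      unfolding F sum_distrib_left sum.distrib[symmetric]
      using s by (intro sum_mono convex_onD[OF convex]) auto
  qed simp
  have Fmin: "F xstar \<le> F u" for u
    using xstar by (simp add: is_arg_min_linorder)
  have step: "F (pfun \<mu> f i (\<lambda>_. v)) + c * (norm (u - pfun \<mu> f i (\<lambda>_. v)))\<^sup>2
      \<le> F u + c * (norm (u - v))\<^sup>2" for i u v
    unfolding F c_def
    by (rule pfun_step_bound[OF K convex differentiable upper mu(1)])
  have best_le: "best k \<le> F (x k i)" for k i
    unfolding best by (rule Min_le) auto
  have best_ge: "F xstar \<le> best k" for k
    unfolding best using Fmin by (subst Min_ge_iff) auto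
  have rate: "best k - F xstar \<le> 2 * (real CARD('k) - 1) * R / (\<mu> * (real k + 1)\<^sup>2)"
    if k: "k \<ge> 1" for k
  proof -
    have tk: "t k \<ge> (real k + 1) / 2"
      using famsa k by (intro FISTA_parameters(1)) (auto simp: FaMSA_def)
    \<comment> \<open>Replacing each value by the smallest one and dropping the nonnegative
      distances gives equal summands, so the factor \<open>K\<close> cancels against the one in the
      potential bound.\<close>
    have "real CARD('k) * ((t k)\<^sup>2 * (best k - F xstar))
        = (\<Sum>i\<in>(UNIV::'k set). (t k)\<^sup>2 * (best k - F xstar))" by simp
    also have "\<dots> \<le> (\<Sum>i\<in>UNIV. (t k)\<^sup>2 * (F (x k i) - F xstar)
      + c * (norm (t k *\<^sub>R x k i - (t k - 1) *\<^sub>R wh (k - 1) i - xstar))\<^sup>2)"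
      using c best_le by (intro sum_mono add_increasing2 mult_left_mono) auto
    also have "\<dots> \<le> real CARD('k) * (c * R)"
      unfolding R_def by (rule FaMSA_potential_bound[OF famsa D conv step k])
    finally have "(t k)\<^sup>2 * (best k - F xstar) \<le> c * R" using K1 by simp
    moreover have "((real k + 1) / 2)\<^sup>2 * (best k - F xstar) \<le> (t k)\<^sup>2 * (best k - F xstar)"
      using tk best_ge[of k] by (intro mult_right_mono power_mono) auto
    ultimately have "((real k + 1) / 2)\<^sup>2 * (best k - F xstar) \<le> c * R" by linarith
    then show ?thesis using mu(1) by (simp add: c_def field_simps)
  qed
  have lim: "best \<longlonglongrightarrow> F xstar"
  proof (rule real_tendsto_sandwich)
    show "\<forall>\<^sub>F k in sequentially. F xstar \<le> best k"
      using best_ge by simp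
    show "\<forall>\<^sub>F k in sequentially. best k
        \<le> F xstar + 2 * (real CARD('k) - 1) * R / \<mu> * (inverse (real (Suc k)))\<^sup>2"
    proof (rule eventually_sequentiallyI)
      fix k :: nat assume "1 \<le> k"
      from rate[OF this] show "best k
        \<le> F xstar + 2 * (real CARD('k) - 1) * R / \<mu> * (inverse (real (Suc k)))\<^sup>2"
        by (simp add: field_simps)
    qed
    have "(\<lambda>k. F xstar + 2 * (real CARD('k) - 1) * R / \<mu> * (inverse (real (Suc k)))\<^sup>2)
        \<longlonglongrightarrow> F xstar + 2 * (real CARD('k) - 1) * R / \<mu> * 0\<^sup>2"
      by (intro tendsto_intros LIMSEQ_inverse_real_of_nat)
    then show "(\<lambda>k. F xstar + 2 * (real CARD('k) - 1) * R / \<mu> * (inverse (real (Suc k)))\<^sup>2)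
        \<longlonglongrightarrow> F xstar" by simp
  qed simp
  have complexity: "(\<exists>k. best k - F xstar \<le> \<epsilon>) \<and>
      int (LEAST k. best k - F xstar \<le> \<epsilon>) \<le> \<lfloor>sqrt (C / \<epsilon>)\<rfloor>"
    if \<beta>: "0 < \<beta>" "\<beta> \<le> 1" "\<mu> \<ge> \<beta> / M"
      and C: "C = 2 * (real CARD('k) - 1) * M * R / \<beta>" and \<epsilon>: "\<epsilon> > 0" for \<beta> C \<epsilon>
  proof -
    \<comment> \<open>For this \<open>k\<close>, \<open>k + 1\<close> exceeds
      \<open>sqrt (C / \<epsilon>)\<close>, so a gap of at most
      \<open>C / (real k + 1)\<^sup>2\<close> suffices; the floor may be 0.\<close>
    define k where "k = nat \<lfloor>sqrt (C / \<epsilon>)\<rfloor>"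
    have C0: "C \<ge> 0" using K1 M R \<beta> by (simp add: C)
    have k_int: "int k = \<lfloor>sqrt (C / \<epsilon>)\<rfloor>" using C0 \<epsilon> by (simp add: k_def)
    then have "sqrt (C / \<epsilon>) < real k + 1" by linarith
    then have "(sqrt (C / \<epsilon>))\<^sup>2 \<le> (real k + 1)\<^sup>2"
      using C0 \<epsilon> by (intro power_mono) auto
    then have "C / \<epsilon> \<le> (real k + 1)\<^sup>2" using C0 \<epsilon> by simp
    then have C_le: "C / (real k + 1)\<^sup>2 \<le> \<epsilon>" using \<epsilon> by (simp add: field_simps)
    have "best k - F xstar \<le> C / (real k + 1)\<^sup>2"
    proof (cases "k = 0")
      case False
      \<comment> \<open>The lower bound on \<open>\<mu>\<close> trades \<open>1 / \<mu>\<close> in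
        the rate for the factor \<open>M / \<beta>\<close> in \<open>C\<close>.\<close>
      have "1 / \<mu> \<le> M / \<beta>" using \<beta> M mu by (simp add: field_simps)
      then have "2 * (real CARD('k) - 1) * R * (1 / \<mu>) \<le> 2 * (real CARD('k) - 1) * R * (M / \<beta>)"
        using K1 R by (intro mult_left_mono) auto
      then have "2 * (real CARD('k) - 1) * R / \<mu> / (real k + 1)\<^sup>2 \<le> C / (real k + 1)\<^sup>2"
        by (intro divide_right_mono) (auto simp: C mult_ac)
      then show ?thesis using rate[of k] False by simp
    next
      \<comment> \<open>The rate says nothing at \<open>x0\<close>; there the descent lemma at \<open>xstar\<close> is used.\<close>
      case True
      define G where "G = (\<Sum>i\<in>UNIV. grad (f i) xstar)"
      have bnd: "F u \<le> F xstar + G \<bullet> (u - xstar) + real CARD('k) * (M / 2 * (norm (u - xstar))\<^sup>2)" for u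
        unfolding F G_def inner_sum_left
        using sum_mono[of UNIV, OF descent[OF LM, of _ u xstar]] by (simp add: sum.distrib)
      \<comment> \<open>Stationarity of \<open>xstar\<close> follows from the quadratic bound: a
        gradient step of length \<open>1 / a\<close> would lower \<open>F\<close> by at least
        \<open>(norm G)\<^sup>2 / (2 * a)\<close>, against minimality.\<close>
      have "G = 0"
      proof -
        define a where "a = real CARD('k) * M"
        have a: "a > 0" using K1 M by (simp add: a_def)
        have "F xstar \<le> F (xstar - (1 / a) *\<^sub>R G)" by (rule Fmin)
        also have "\<dots> \<le> F xstar - (norm G)\<^sup>2 / a + a / 2 * (norm G / a)\<^sup>2"
          using bnd[of "xstar - (1 / a) *\<^sub>R G"] a by (simp add: a_def power2_norm_eq_inner)
        also have "\<dots> = F xstar - (norm G)\<^sup>2 / (2 * a)"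
          using a by (simp add: field_simps power2_eq_square)
        finally have "(norm G)\<^sup>2 / (2 * a) \<le> 0" by simp
        then have "(norm G)\<^sup>2 \<le> 0" using a by (simp add: field_simps)
        then show ?thesis by simp
      qed
      have "x 0 i = x0" for i using famsa by (simp add: FaMSA_def)
      then have "best k - F xstar \<le> real CARD('k) * (M / 2 * R)"
        using best_le[of 0] bnd[of x0] \<open>G = 0\<close> True by (simp add: R_def algebra_simps)
      also have "\<dots> = real CARD('k) / 2 * (M * R)" by simp
      \<comment> \<open>\<open>K / 2 \<le> 2 * (K - 1)\<close> holds as \<open>K \<ge> 2\<close>,
        and dividing by \<open>\<beta> \<le> 1\<close> afterwards only enlarges the bound. At
        \<open>k = 0\<close> the target is \<open>C\<close> itself.\<close>
      also have "\<dots> \<le> 2 * (real CARD('k) - 1) * (M * R)"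
        using K1 M R by (intro mult_right_mono) auto
      also have "\<dots> \<le> 2 * (real CARD('k) - 1) * (M * R) / \<beta>"
        using \<beta> K1 M R by (simp add: le_divide_eq mult_left_le)
      finally show ?thesis by (simp add: C True mult.assoc)
    qed
    with C_le have "best k - F xstar \<le> \<epsilon>" by linarith
    then show ?thesis using k_int Least_le[of "\<lambda>k. best k - F xstar \<le> \<epsilon>" k] by fastforce
  qed
  show ?thesis
    using rate lim complexity unfolding R_def M_def by blast
qed

end
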